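(* Let $R$ be a unital, associative ring such that $\sigma(R)$ is finite. Then there exist a two-sided ideal $I$ of $R$ and a prime $p$ such that $R/I$ is finite, $R/I$ has characteristic $p$, $J(R/I)^2 = \{0\}$, and $\sigma(R/I) = \sigma(R)$.
   Context: $J(A)$ denotes the Jacobson radical of a ring $A$. A subring of a ring $R$ is a subset that is a group under addition and is closed under multiplication; it need not contain a multiplicative identity. A cover of $R$ is a collection of proper subrings of $R$ whose set-theoretic union equals $R$. If a cover exists, $R$ is coverable and $\sigma(R)$ denotes the cardinality of a minimal cover (a cover of least cardinality); "$\sigma(R)$ is finite" means that $R$ is coverable with a finite cover. *)

theory Defs
  imports
    "HOL-Algebra.Ideal_Product"
    "HOL-Algebra.QuotRing"
    "HOL-Computational_Algebra.Primes"
begin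

unbundle cardinal_syntax

section \<open>Coverings of a ring by proper subrings\<close>

text \<open>
  A subring here need not contain a multiplicative identity, so this is not the library's
  \<open>subring\<close> (from \<open>HOL-Algebra.Subrings\<close>), which requires \<open>\<one>\<close> to lie in the subset.
\<close>

definition nonunital_subring :: "'a set \<Rightarrow> ('a, 'm) ring_scheme \<Rightarrow> bool" where
  "nonunital_subring S R \<longleftrightarrow>
     additive_subgroup S R \<and> (\<forall>x\<in>S. \<forall>y\<in>S. x \<otimes>\<^bsub>R\<^esub> y \<in> S)"

definition ring_cover :: "('a, 'm) ring_scheme \<Rightarrow> 'a set set \<Rightarrow> bool" where
  "ring_cover R C \<longleftrightarrow>
     (\<forall>S\<in>C. nonunital_subring S R \<and> S \<noteq> carrier R) \<and> \<Union>C = carrier R"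

definition coverable :: "('a, 'm) ring_scheme \<Rightarrow> bool" where
  "coverable R \<longleftrightarrow> (\<exists>C. ring_cover R C)"

definition minimal_ring_cover :: "('a, 'm) ring_scheme \<Rightarrow> 'a set set \<Rightarrow> bool" where
  "minimal_ring_cover R C \<longleftrightarrow> ring_cover R C \<and> (\<forall>D. ring_cover R D \<longrightarrow> |C| \<le>o |D| )"

text \<open>
  The covering number is a (possibly infinite) cardinal, so covering numbers of rings over
  different types are compared by \<open>=o\<close>. Its value is meaningful for coverable rings only.
\<close>

definition covering_number :: "('a, 'm) ring_scheme \<Rightarrow> 'a set rel" (\<open>\<sigma>\<close>) where
  "\<sigma> R = |SOME C. minimal_ring_cover R C|"

lemma minimal_ring_cover_exists:
  assumes "coverable R"
  shows "\<exists>C. minimal_ring_cover R C"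
proof -
  let ?K = "{ |C| | C. ring_cover R C}"
  have "?K \<noteq> {}" "\<forall>r\<in>?K. Card_order r"
    using assms card_of_Card_order by (auto simp: coverable_def)
  then obtain r where "r \<in> ?K" "\<forall>r'\<in>?K. r \<le>o r'"
    using exists_minim_Card_order[of ?K] by blast
  then show ?thesis
    unfolding minimal_ring_cover_def by blast
qed

lemma covering_number_ordIso:
  assumes "minimal_ring_cover R C"
  shows "\<sigma> R =o |C|"
proof -
  have "minimal_ring_cover R (SOME C. minimal_ring_cover R C)"
    using assms by (rule someI)
  then show ?thesis
    using assms unfolding covering_number_def minimal_ring_cover_def ordIso_iff_ordLeq by blast
qed


section \<open>The Jacobson radical and the characteristic\<close>

definition left_ideal :: "'a set \<Rightarrow> ('a, 'm) ring_scheme \<Rightarrow> bool" where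
  "left_ideal L R \<longleftrightarrow>
     additive_subgroup L R \<and> (\<forall>r\<in>carrier R. \<forall>x\<in>L. r \<otimes>\<^bsub>R\<^esub> x \<in> L)"

definition maximal_left_ideal :: "'a set \<Rightarrow> ('a, 'm) ring_scheme \<Rightarrow> bool" where
  "maximal_left_ideal L R \<longleftrightarrow>
     left_ideal L R \<and> L \<noteq> carrier R \<and>
     (\<forall>L'. left_ideal L' R \<longrightarrow> L \<subseteq> L' \<longrightarrow> L' = L \<or> L' = carrier R)"

definition jacobson_radical :: "('a, 'm) ring_scheme \<Rightarrow> 'a set" where
  "jacobson_radical R = carrier R \<inter> \<Inter>{L. maximal_left_ideal L R}"

definition ring_characteristic :: "('a, 'm) ring_scheme \<Rightarrow> nat" where
  "ring_characteristic R =
     (if \<exists>n::nat. n > 0 \<and> [n] \<cdot>\<^bsub>R\<^esub> \<one>\<^bsub>R\<^esub> = \<zero>\<^bsub>R\<^esub>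
      then LEAST n::nat. n > 0 \<and> [n] \<cdot>\<^bsub>R\<^esub> \<one>\<^bsub>R\<^esub> = \<zero>\<^bsub>R\<^esub>
      else 0)"

end

theory Submission
  imports Defs
begin

text \<open>
  A minimal finite cover is irredundant, so the intersection of its members has finite index and
  contains an ideal of finite index. Among the ideals contained in all members of some cover of
  the same size, and above that one, take a maximal \<open>I\<close>. In the finite ring \<open>A = R/I\<close> no nonzero
  ideal \<open>K\<close> can be added to the members of the cover so that those sums \<open>S + K\<close> which remain
  proper still cover \<open>A\<close>. If the characteristic of \<open>A\<close> were not prime, such a \<open>K\<close> could be found
  among the ideals \<open>kA\<close>; if \<open>J(A)\<^sup>2 \<noteq> 0\<close>, the last nonzero power of \<open>J(A)\<close> would do.
\<close>

text \<open>\<open>R\<close> may be infinite and have infinitely many ideals. Finite index is used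
  twice: it leaves only finitely many ideals above a fixed one, so that a maximal \<open>I\<close>
  exists, and it makes \<open>R Quot I\<close> finite, which yields a positive characteristic and a
  nilpotent radical. Every cover of \<open>R Quot I\<close> pulls back to a cover of
  \<open>R\<close> with no more members, so the covering number cannot drop in the quotient; only an
  upper bound has to be carried along. A sum \<open>S <+> K\<close> is lost exactly when it is the
  whole ring. In the radical case no proper \<open>S\<close> is lost. For composite characteristic
  two ideals with product zero may be needed: a single \<open>S\<close> cannot be lost for both of
  them, although each of them may lose some members.\<close>

no_notation Sum_Type.Plus (infixr \<open><+>\<close> 65)

section \<open>Subrings and covers\<close>

lemma nonunital_subringD:
  assumes "nonunital_subring S R"
  shows "additive_subgroup S R" "\<And>x y. x \<in> S \<Longrightarrow> y \<in> S \<Longrightarrow> x \<otimes>\<^bsub>R\<^esub> y \<in> S"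
  using assms by (auto simp: nonunital_subring_def)

context ring
begin

lemma additive_subgroupI_minus:
  assumes "H \<subseteq> carrier R" "\<zero> \<in> H" "\<And>x y. x \<in> H \<Longrightarrow> y \<in> H \<Longrightarrow> x \<ominus> y \<in> H"
  shows "additive_subgroup H R"
proof (rule additive_subgroupI, rule add.subgroupI)
  have neg: "\<ominus> x \<in> H" if "x \<in> H" for x
    using assms(3)[OF assms(2) that] that assms(1) by (auto simp: minus_eq)
  then show "\<And>a. a \<in> H \<Longrightarrow> \<ominus> a \<in> H" .
  show "x \<oplus> y \<in> H" if "x \<in> H" "y \<in> H" for x y
  proof -
    have "x \<oplus> y = x \<ominus> (\<ominus> y)"
      using that assms(1) by (auto simp: minus_eq)
    then show ?thesis
      using assms(3) that neg by simp
  qed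
qed (use assms in auto)

lemma additive_subgroup_minus:
  assumes "additive_subgroup H R" "x \<in> H" "y \<in> H"
  shows "x \<ominus> y \<in> H"
  using assms by (simp add: minus_eq additive_subgroup.a_closed additive_subgroup.a_inv_closed)

lemma idealI_minus:
  assumes "additive_subgroup I R"
    and "\<And>a x. \<lbrakk>a \<in> I; x \<in> carrier R\<rbrakk> \<Longrightarrow> x \<otimes> a \<in> I"
    and "\<And>a x. \<lbrakk>a \<in> I; x \<in> carrier R\<rbrakk> \<Longrightarrow> a \<otimes> x \<in> I"
  shows "ideal I R"
  using assms ring_axioms by (intro idealI additive_subgroup.a_subgroup) auto

lemma mem_set_add_iff: "x \<in> H <+> K \<longleftrightarrow> (\<exists>h\<in>H. \<exists>k\<in>K. x = h \<oplus> k)"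
  by (auto simp: set_add_def')

lemma nonunital_subring_add_ideal:
  assumes S: "nonunital_subring S R" and K: "ideal K R"
  shows "nonunital_subring (S <+> K) R" "S \<subseteq> S <+> K" "K \<subseteq> S <+> K"
proof -
  interpret S: additive_subgroup S R by (rule nonunital_subringD(1)[OF S])
  interpret K: ideal K R by (rule K)
  note carr = S.a_Hcarr K.a_Hcarr
  show "nonunital_subring (S <+> K) R"
    unfolding nonunital_subring_def
  proof (intro conjI ballI)
    show "additive_subgroup (S <+> K) R"
    proof (rule additive_subgroupI_minus)
      show "S <+> K \<subseteq> carrier R"
        by (auto simp: mem_set_add_iff carr)
      show "\<zero> \<in> S <+> K"
        unfolding mem_set_add_iff by (rule bexI[of _ \<zero>], rule bexI[of _ \<zero>]) auto
      fix x y assume "x \<in> S <+> K" "y \<in> S <+> K"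
      then obtain s k t l where *: "s \<in> S" "k \<in> K" "t \<in> S" "l \<in> K" "x = s \<oplus> k" "y = t \<oplus> l"
        by (auto simp: mem_set_add_iff)
      then have "x \<ominus> y = (s \<ominus> t) \<oplus> (k \<ominus> l)"
        using carr by (simp, algebra)
      moreover have "s \<ominus> t \<in> S" "k \<ominus> l \<in> K"
        using * additive_subgroup_minus S.additive_subgroup_axioms K.additive_subgroup_axioms by auto
      ultimately show "x \<ominus> y \<in> S <+> K"
        by (auto simp: mem_set_add_iff)
    qed
  next
    fix x y assume "x \<in> S <+> K" "y \<in> S <+> K"
    then obtain s k t l where *: "s \<in> S" "k \<in> K" "t \<in> S" "l \<in> K" "x = s \<oplus> k" "y = t \<oplus> l"
      by (auto simp: mem_set_add_iff)
    then have "x \<otimes> y = (s \<otimes> t) \<oplus> (s \<otimes> l \<oplus> k \<otimes> (t \<oplus> l))"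
      using carr by (simp, algebra)
    moreover have "s \<otimes> t \<in> S" "s \<otimes> l \<oplus> k \<otimes> (t \<oplus> l) \<in> K"
      using * nonunital_subringD(2)[OF S] by (auto simp: carr K.I_l_closed K.I_r_closed)
    ultimately show "x \<otimes> y \<in> S <+> K"
      by (auto simp: mem_set_add_iff)
  qed
  show "S \<subseteq> S <+> K"
  proof
    fix x assume "x \<in> S"
    then show "x \<in> S <+> K"
      unfolding mem_set_add_iff using carr by (intro bexI[of _ x] bexI[of _ \<zero>]) auto
  qed
  show "K \<subseteq> S <+> K"
  proof
    fix x assume "x \<in> K"
    then show "x \<in> S <+> K"
      unfolding mem_set_add_iff using carr by (intro bexI[of _ \<zero>] bexI[of _ x]) auto
  qed
qed

text \<open>For a cover \<open>C\<close> and an ideal \<open>K\<close>, all members contain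
  \<open>K\<close>, and there are no more of them than in \<open>C\<close>. Since sums equal to the
  whole ring are dropped, the only thing that can fail is that the rest covers.\<close>

definition enlarged :: "'a set set \<Rightarrow> 'a set \<Rightarrow> 'a set set" where
  "enlarged C K = {S <+> K | S. S \<in> C \<and> S <+> K \<noteq> carrier R}"

lemma enlarged_subset: "enlarged C K \<subseteq> (\<lambda>S. S <+> K) ` C"
  by (auto simp: enlarged_def)

lemma ring_cover_enlarged_iff:
  assumes C: "ring_cover R C" and K: "ideal K R"
  shows "ring_cover R (enlarged C K) \<longleftrightarrow> carrier R \<subseteq> \<Union>(enlarged C K)"
proof -
  have "nonunital_subring T R \<and> T \<noteq> carrier R" if "T \<in> enlarged C K" for T
    using that C nonunital_subring_add_ideal(1)[OF _ K] by (auto simp: enlarged_def ring_cover_def)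
  then show ?thesis
    unfolding ring_cover_def
    by (auto dest: nonunital_subringD(1) additive_subgroup.a_Hcarr)
qed

text \<open>Members of a cover are proper, so \<open>eq\<close> says that no sum is dropped; and
  each sum contains the member it came from.\<close>

lemma ring_cover_enlargedI:
  assumes C: "ring_cover R C" and K: "ideal K R"
    and eq: "\<And>S. S \<in> C \<Longrightarrow> S <+> K = carrier R \<Longrightarrow> S = carrier R"
  shows "ring_cover R (enlarged C K)"
  unfolding ring_cover_enlarged_iff[OF C K]
proof
  fix x assume "x \<in> carrier R"
  then obtain S where S: "S \<in> C" "x \<in> S"
    using C by (auto simp: ring_cover_def)
  then have "S <+> K \<noteq> carrier R" "S \<subseteq> S <+> K"
    using C eq nonunital_subring_add_ideal(2)[OF _ K] by (auto simp: ring_cover_def)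
  then show "x \<in> \<Union>(enlarged C K)"
    using S by (auto simp: enlarged_def)
qed

end

section \<open>Images and preimages of subrings and covers under ring homomorphisms\<close>

lemma (in ring_hom_ring) nonunital_subring_vimage:
  assumes "nonunital_subring X S"
  shows "nonunital_subring {x \<in> carrier R. h x \<in> X} R"
proof -
  interpret X: additive_subgroup X S by (rule nonunital_subringD(1)[OF assms])
  show ?thesis
    unfolding nonunital_subring_def
    by (auto intro!: R.additive_subgroupI_minus nonunital_subringD(2)[OF assms]
        simp: R.minus_eq)
qed

lemma (in ring_hom_ring) nonunital_subring_image:
  assumes "nonunital_subring T R"
  shows "nonunital_subring (h ` T) S"
proof -
  interpret T: additive_subgroup T R by (rule nonunital_subringD(1)[OF assms])
  have "h x \<ominus>\<^bsub>S\<^esub> h y \<in> h ` T" if "x \<in> T" "y \<in> T" for x y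
  proof
    show "h x \<ominus>\<^bsub>S\<^esub> h y = h (x \<ominus> y)"
      using that T.a_Hcarr by (simp add: R.minus_eq S.minus_eq)
    show "x \<ominus> y \<in> T"
      using that R.additive_subgroup_minus T.additive_subgroup_axioms by blast
  qed
  moreover have "h x \<otimes>\<^bsub>S\<^esub> h y \<in> h ` T" if "x \<in> T" "y \<in> T" for x y
  proof
    show "h x \<otimes>\<^bsub>S\<^esub> h y = h (x \<otimes> y)"
      using that T.a_Hcarr by simp
    show "x \<otimes> y \<in> T"
      using that nonunital_subringD(2)[OF assms] by blast
  qed
  moreover have "\<zero>\<^bsub>S\<^esub> \<in> h ` T"
    by (rule image_eqI[of _ _ \<zero>]) auto
  ultimately show ?thesis
    unfolding nonunital_subring_def
    by (auto intro!: S.additive_subgroupI_minus dest: T.a_Hcarr)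
qed

text \<open>Surjectivity keeps preimages proper: if the preimage of \<open>X\<close> were
  everything, \<open>X\<close> would contain the image of \<open>h\<close>, which is
  \<open>carrier S\<close>.\<close>

lemma (in ring_hom_ring) ring_cover_vimage:
  assumes surj: "h ` carrier R = carrier S" and D: "ring_cover S D"
  shows "ring_cover R ((\<lambda>X. {x \<in> carrier R. h x \<in> X}) ` D)"
proof -
  have "{x \<in> carrier R. h x \<in> X} \<noteq> carrier R" if "X \<in> D" for X
  proof
    assume *: "{x \<in> carrier R. h x \<in> X} = carrier R"
    have "carrier S \<subseteq> X"
      unfolding surj[symmetric] using * by blast
    moreover have "X \<subseteq> carrier S"
      using that D by (auto simp: ring_cover_def)
    ultimately show False
      using that D by (auto simp: ring_cover_def)
  qed
  moreover have "carrier R \<subseteq> \<Union>((\<lambda>X. {x \<in> carrier R. h x \<in> X}) ` D)"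
  proof
    fix x assume x: "x \<in> carrier R"
    then obtain X where "X \<in> D" "h x \<in> X"
      using D hom_closed unfolding ring_cover_def by blast
    then show "x \<in> \<Union>((\<lambda>X. {x \<in> carrier R. h x \<in> X}) ` D)"
      using x by auto
  qed
  moreover have "nonunital_subring {x \<in> carrier R. h x \<in> X} R" if "X \<in> D" for X
    using that D nonunital_subring_vimage by (simp add: ring_cover_def)
  ultimately show ?thesis
    unfolding ring_cover_def by (intro conjI ballI subset_antisym) auto
qed

text \<open>A subring containing the kernel is a union of fibres of \<open>h\<close>. Hence its
  image can be everything only if it is everything itself, which keeps the images of a cover
  proper.\<close>

lemma (in ring_hom_ring) mem_of_kernel_subset:
  assumes T: "nonunital_subring T R" and "a_kernel R S h \<subseteq> T"
    and "x \<in> carrier R" "h x \<in> h ` T"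
  shows "x \<in> T"
proof -
  interpret T: additive_subgroup T R by (rule nonunital_subringD(1)[OF T])
  obtain t where t: "t \<in> T" "h x = h t"
    using assms by blast
  then have "h (x \<ominus> t) = \<zero>\<^bsub>S\<^esub>"
    using assms(3) T.a_Hcarr[OF t(1)] by (simp add: R.minus_eq S.r_neg)
  moreover have "x \<ominus> t \<in> carrier R"
    using assms(3) T.a_Hcarr[OF t(1)] by blast
  ultimately have "x \<ominus> t \<in> a_kernel R S h"
    unfolding a_kernel_def' by blast
  then have "x \<ominus> t \<in> T"
    using assms(2) by blast
  moreover have "x = (x \<ominus> t) \<oplus> t"
    using assms(3) T.a_Hcarr[OF t(1)] by algebra
  ultimately show ?thesis
    using t by (metis T.a_closed)
qed

lemma (in ring_hom_ring) ring_cover_image: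
  assumes surj: "h ` carrier R = carrier S" and C: "ring_cover R C"
    and ker: "\<And>T. T \<in> C \<Longrightarrow> a_kernel R S h \<subseteq> T"
  shows "ring_cover S ((`) h ` C)"
proof -
  have "h ` T \<noteq> carrier S" if "T \<in> C" for T
  proof
    assume *: "h ` T = carrier S"
    have T: "nonunital_subring T R" "T \<noteq> carrier R"
      using that C by (simp_all add: ring_cover_def)
    have "carrier R \<subseteq> T"
    proof
      fix x assume "x \<in> carrier R"
      then show "x \<in> T"
        using mem_of_kernel_subset[OF T(1) ker[OF that]] * by simp
    qed
    then show False
      using T additive_subgroup.a_subset[OF nonunital_subringD(1)] by blast
  qed
  moreover have "\<Union>((`) h ` C) = carrier S"
  proof -
    have "\<Union>C = carrier R"
      using C by (simp add: ring_cover_def)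
    then show ?thesis
      using surj image_Union[of h C] by metis
  qed
  moreover have "nonunital_subring (h ` T) S" if "T \<in> C" for T
    using that C nonunital_subring_image by (simp add: ring_cover_def)
  ultimately show ?thesis
    unfolding ring_cover_def by (intro conjI ballI) auto
qed

section \<open>Subrings of finite index\<close>

context ring
begin

text \<open>Finitely many cosets of \<open>H\<close> cover \<open>K\<close>. The representatives may
  lie outside \<open>K\<close>, and \<open>H\<close> need not lie inside \<open>K\<close>, so
  translating and uniting sets of representatives is harmless.\<close>

definition fin_cosets :: "'a set \<Rightarrow> 'a set \<Rightarrow> bool" where
  "fin_cosets K H \<longleftrightarrow> (\<exists>F. finite F \<and> F \<subseteq> carrier R \<and> (\<forall>x\<in>K. \<exists>f\<in>F. x \<ominus> f \<in> H))"

lemma fin_cosets_mono: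
  assumes "fin_cosets K H" "H \<subseteq> H'"
  shows "fin_cosets K H'"
proof -
  obtain F where "finite F" "F \<subseteq> carrier R" "\<forall>x\<in>K. \<exists>f\<in>F. x \<ominus> f \<in> H"
    using assms(1) by (auto simp: fin_cosets_def)
  then show ?thesis
    unfolding fin_cosets_def using assms(2) by (intro exI[of _ F]) blast
qed

text \<open>One chosen preimage for each value of \<open>\<phi>\<close> gives the
  representatives.\<close>

lemma fin_cosets_of_finite_image:
  assumes "finite (\<phi> ` K)" "K \<subseteq> carrier R"
    and "\<And>x y. \<lbrakk>x \<in> K; y \<in> K; \<phi> x = \<phi> y\<rbrakk> \<Longrightarrow> x \<ominus> y \<in> H"
  shows "fin_cosets K H"
  unfolding fin_cosets_def
proof (intro exI conjI ballI)
  let ?F = "inv_into K \<phi> ` \<phi> ` K"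
  show "finite ?F"
    using assms(1) by blast
  show "?F \<subseteq> carrier R"
    using assms(2) inv_into_into[of _ \<phi> K] by blast
  fix x assume "x \<in> K"
  then show "\<exists>f\<in>?F. x \<ominus> f \<in> H"
    using assms(3)[of x "inv_into K \<phi> (\<phi> x)"] inv_into_into[of "\<phi> x" \<phi> K] f_inv_into_f[of "\<phi> x" \<phi> K]
    by auto
qed

text \<open>The map \<open>\<phi>\<close> stands in for the quotient map: it has finitely many
  values, and equal values force the same coset. Finite tables of such values can then be
  compared.\<close>

lemma fin_cosets_carrierE:
  assumes H: "additive_subgroup H R" and fin: "fin_cosets (carrier R) H"
  obtains \<phi> where "finite (\<phi> ` carrier R)" "\<phi> ` carrier R \<subseteq> carrier R"
    "\<And>x. x \<in> carrier R \<Longrightarrow> x \<ominus> \<phi> x \<in> H"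
    "\<And>x y. \<lbrakk>x \<in> carrier R; y \<in> carrier R; \<phi> x = \<phi> y\<rbrakk> \<Longrightarrow> x \<ominus> y \<in> H"
proof -
  obtain F where F: "finite F" "F \<subseteq> carrier R" "\<forall>x\<in>carrier R. \<exists>f\<in>F. x \<ominus> f \<in> H"
    using fin by (auto simp: fin_cosets_def)
  then obtain \<phi> where \<phi>: "\<And>x. x \<in> carrier R \<Longrightarrow> \<phi> x \<in> F \<and> x \<ominus> \<phi> x \<in> H"
    by metis
  show ?thesis
  proof
    show "finite (\<phi> ` carrier R)"
      using \<phi> F(1) by (auto intro: finite_subset)
    show "\<phi> ` carrier R \<subseteq> carrier R"
      using \<phi> F(2) by auto
    show "x \<ominus> \<phi> x \<in> H" if "x \<in> carrier R" for x
      using \<phi> that by auto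
    show "x \<ominus> y \<in> H" if "x \<in> carrier R" "y \<in> carrier R" "\<phi> x = \<phi> y" for x y
    proof -
      have c: "\<phi> y \<in> carrier R"
        using \<phi> F(2) that(2) by auto
      have "x \<ominus> \<phi> y \<in> H" "y \<ominus> \<phi> y \<in> H"
        using \<phi>[OF that(1)] \<phi>[OF that(2)] that(3) by simp_all
      then have "(x \<ominus> \<phi> y) \<ominus> (y \<ominus> \<phi> y) \<in> H"
        using additive_subgroup_minus[OF H] by blast
      moreover have "(x \<ominus> \<phi> y) \<ominus> (y \<ominus> \<phi> y) = x \<ominus> y"
        using that(1,2) c by algebra
      ultimately show ?thesis by simp
    qed
  qed
qed

text \<open>
  For a proper subfamily \<open>S\<close> of an irredundant cover, a point \<open>x\<close> outside all members of \<open>S\<close>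
  exists. Then \<open>x + \<Inter>S\<close> avoids every member of \<open>S\<close>, so it is covered by the other members, and
  \<open>\<Inter>S\<close> is a union of finitely many cosets of the groups \<open>T \<inter> \<Inter>S\<close> with \<open>T \<notin> S\<close>.
\<close>
lemma fin_cosets_Inter_irredundant_cover:
  assumes fin: "finite C" and sub: "\<And>T. T \<in> C \<Longrightarrow> additive_subgroup T R"
    and cov: "\<Union>C = carrier R" and irr: "\<And>T. T \<in> C \<Longrightarrow> \<Union>(C - {T}) \<noteq> carrier R"
    and "S \<subseteq> C"
  shows "fin_cosets (carrier R \<inter> \<Inter>S) (carrier R \<inter> \<Inter>C)"
  using \<open>S \<subseteq> C\<close>
proof (induction "card (C - S)" arbitrary: S rule: less_induct)
  case less
  show ?case
  proof (cases "S = C")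
    case True
    then show ?thesis
      unfolding fin_cosets_def by (intro exI[of _ "{\<zero>}"]) (auto simp: minus_eq)
  next
    case False
    then obtain U where U: "U \<in> C" "U \<notin> S"
      using less.prems by auto
    \<comment> \<open>Any member \<open>U\<close> outside \<open>S\<close> will do: irredundancy
      gives a point that lies in no member other than \<open>U\<close>.\<close>
    have "\<Union>(C - {U}) \<subseteq> carrier R"
      using cov by auto
    then obtain x where x: "x \<in> carrier R" "x \<notin> \<Union>(C - {U})"
      using irr[OF U(1)] by blast
    have xS: "x \<notin> T" if "T \<in> S" for T
      using that x(2) U(2) less.prems by auto
    define K where "K = carrier R \<inter> \<Inter>S"
    define D where "D = carrier R \<inter> \<Inter>C"
    \<comment> \<open>The \<open>k\<close> in \<open>K\<close> with
      \<open>x \<oplus> k \<in> T\<close> are either none or, for any \<open>k0\<close> among them,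
      the coset of \<open>T \<inter> K\<close> through \<open>k0\<close>. The induction hypothesis
      for \<open>insert T S\<close> handles \<open>T \<inter> K\<close>; translation by
      \<open>k0\<close> does the rest.\<close>
    have "\<exists>F. finite F \<and> F \<subseteq> carrier R \<and> (\<forall>k\<in>K. x \<oplus> k \<in> T \<longrightarrow> (\<exists>f\<in>F. k \<ominus> f \<in> D))"
      if T: "T \<in> C - S" for T
    proof (cases "\<exists>k0\<in>K. x \<oplus> k0 \<in> T")
      case False
      then show ?thesis by (intro exI[of _ "{}"]) auto
    next
      case True
      then obtain k0 where k0: "k0 \<in> K" "x \<oplus> k0 \<in> T" by blast
      have "C - insert T S \<subset> C - S"
        using T by auto
      then have "card (C - insert T S) < card (C - S)"
        using fin by (intro psubset_card_mono) auto
      then have "fin_cosets (carrier R \<inter> \<Inter>(insert T S)) D"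
        using less.hyps[of "insert T S"] less.prems T by (auto simp: D_def)
      then obtain F where F: "finite F" "F \<subseteq> carrier R"
          "\<And>y. y \<in> K \<Longrightarrow> y \<in> T \<Longrightarrow> \<exists>f\<in>F. y \<ominus> f \<in> D"
        by (auto simp: fin_cosets_def K_def)
      show ?thesis
      proof (intro exI conjI ballI impI)
        show "finite ((\<lambda>f. k0 \<oplus> f) ` F)" "(\<lambda>f. k0 \<oplus> f) ` F \<subseteq> carrier R"
          using F k0 by (auto simp: K_def)
        fix k assume k: "k \<in> K" "x \<oplus> k \<in> T"
        have c: "k \<in> carrier R" "k0 \<in> carrier R"
          using k k0 by (auto simp: K_def)
        have "k \<ominus> k0 = (x \<oplus> k) \<ominus> (x \<oplus> k0)"
          using c x(1) by algebra
        then have "k \<ominus> k0 \<in> T"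
          using additive_subgroup_minus[OF sub k(2) k0(2)] T by simp
        moreover have "k \<ominus> k0 \<in> K"
          using k(1) k0(1) c less.prems additive_subgroup_minus[OF sub]
          unfolding K_def by blast
        ultimately obtain f where f: "f \<in> F" "k \<ominus> k0 \<ominus> f \<in> D"
          using F(3) by blast
        then have "k \<ominus> (k0 \<oplus> f) = k \<ominus> k0 \<ominus> f"
          using c subsetD[OF F(2) f(1)] by algebra
        then have "k \<ominus> (k0 \<oplus> f) \<in> D"
          using f(2) by simp
        then show "\<exists>g\<in>(\<lambda>f. k0 \<oplus> f) ` F. k \<ominus> g \<in> D"
          using f(1) by blast
      qed
    qed
    then obtain G where G: "\<And>T. T \<in> C - S \<Longrightarrow> finite (G T)" "\<And>T. T \<in> C - S \<Longrightarrow> G T \<subseteq> carrier R"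
      "\<And>T k. \<lbrakk>T \<in> C - S; k \<in> K; x \<oplus> k \<in> T\<rbrakk> \<Longrightarrow> \<exists>f\<in>G T. k \<ominus> f \<in> D"
      by metis
    have "fin_cosets K D"
      unfolding fin_cosets_def
    proof (intro exI conjI ballI)
      show "finite (\<Union>T\<in>C - S. G T)" "(\<Union>T\<in>C - S. G T) \<subseteq> carrier R"
        using G fin by auto
      fix k assume k: "k \<in> K"
      then have "x \<oplus> k \<in> carrier R"
        using x by (auto simp: K_def)
      then obtain T where T: "T \<in> C" "x \<oplus> k \<in> T"
        using cov by auto
      have "T \<notin> S"
      proof
        assume "T \<in> S"
        then have "(x \<oplus> k) \<ominus> k \<in> T"
          using additive_subgroup_minus[OF sub[OF T(1)] T(2)] k by (auto simp: K_def)
        moreover have "(x \<oplus> k) \<ominus> k = x"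
          using x(1) k unfolding K_def by (elim IntE) algebra
        ultimately show False
          using xS \<open>T \<in> S\<close> by simp
      qed
      then show "\<exists>f\<in>\<Union>T\<in>C - S. G T. k \<ominus> f \<in> D"
        using G(3)[of T k] T k by auto
    qed
    then show ?thesis
      by (simp add: K_def D_def)
  qed
qed

text \<open>Lewin: membership in \<open>P\<close> and in \<open>I\<close> can be tested on coset representatives.\<close>
lemma ideal_in_subring_of_finite_index:
  assumes S: "nonunital_subring S R" and fin: "fin_cosets (carrier R) S"
  obtains I where "ideal I R" "I \<subseteq> S" "fin_cosets (carrier R) I"
proof -
  interpret S: additive_subgroup S R by (rule nonunital_subringD(1)[OF S])
  obtain \<phi> where \<phi>: "finite (\<phi> ` carrier R)" "\<phi> ` carrier R \<subseteq> carrier R"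
    "\<And>x. x \<in> carrier R \<Longrightarrow> x \<ominus> \<phi> x \<in> S"
    "\<And>x y. \<lbrakk>x \<in> carrier R; y \<in> carrier R; \<phi> x = \<phi> y\<rbrakk> \<Longrightarrow> x \<ominus> y \<in> S"
    by (rule fin_cosets_carrierE[OF S.additive_subgroup_axioms fin]) (rule that)
  \<comment> \<open>\<open>P\<close> is the largest right ideal of \<open>R\<close> inside
    \<open>S\<close>, and \<open>I\<close> below is the largest two-sided ideal inside
    \<open>S\<close>: absorption is enforced one side at a time.\<close>
  define P where "P = {s \<in> S. \<forall>r\<in>carrier R. s \<otimes> r \<in> S}"
  have Pcarr: "x \<in> carrier R" if "x \<in> P" for x
    using that S.a_Hcarr by (auto simp: P_def)
  have P_sub: "additive_subgroup P R"
  proof (rule additive_subgroupI_minus)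
    fix x y assume xy: "x \<in> P" "y \<in> P"
    have "(x \<ominus> y) \<otimes> r = x \<otimes> r \<ominus> y \<otimes> r" if "r \<in> carrier R" for r
      using that xy[THEN Pcarr] by algebra
    then show "x \<ominus> y \<in> P"
      using xy additive_subgroup_minus[OF S.additive_subgroup_axioms] by (auto simp: P_def)
  qed (use Pcarr in \<open>auto simp: P_def\<close>)
  have P_right: "x \<otimes> r \<in> P" if "x \<in> P" "r \<in> carrier R" for x r
    using that Pcarr[OF that(1)] by (auto simp: P_def m_assoc)
  have P_fin: "fin_cosets (carrier R) P"
  proof (rule fin_cosets_of_finite_image)
    \<comment> \<open>The entry \<open>\<phi> s\<close> is recorded because \<open>S\<close> absorbs
      only products of its own elements: it puts \<open>x \<ominus> y\<close> in \<open>S\<close>,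
      so that \<open>(x \<ominus> y) \<otimes> (r \<ominus> \<phi> r)\<close> lies in
      \<open>S\<close> too.\<close>
    let ?\<psi> = "\<lambda>s. (\<phi> s, \<lambda>f\<in>\<phi> ` carrier R. \<phi> (s \<otimes> f))"
    have "?\<psi> ` carrier R \<subseteq> \<phi> ` carrier R \<times> (\<phi> ` carrier R \<rightarrow>\<^sub>E \<phi> ` carrier R)"
    proof
      fix z assume "z \<in> ?\<psi> ` carrier R"
      then obtain s where s: "s \<in> carrier R" "z = ?\<psi> s" by blast
      have "\<phi> (s \<otimes> f) \<in> \<phi> ` carrier R" if "f \<in> \<phi> ` carrier R" for f
        using s(1) that \<phi>(2) by (intro imageI m_closed) auto
      then show "z \<in> \<phi> ` carrier R \<times> (\<phi> ` carrier R \<rightarrow>\<^sub>E \<phi> ` carrier R)"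
        using s by auto
    qed
    then show "finite (?\<psi> ` carrier R)"
      by (rule finite_subset) (simp add: finite_PiE \<phi>(1))
    fix x y assume x: "x \<in> carrier R" and y: "y \<in> carrier R" and "?\<psi> x = ?\<psi> y"
    then have eq: "\<phi> x = \<phi> y" "(\<lambda>f\<in>\<phi> ` carrier R. \<phi> (x \<otimes> f)) = (\<lambda>f\<in>\<phi> ` carrier R. \<phi> (y \<otimes> f))"
      by simp_all
    have xyS: "x \<ominus> y \<in> S"
      using \<phi>(4)[OF x y eq(1)] .
    have "(x \<ominus> y) \<otimes> r \<in> S" if r: "r \<in> carrier R" for r
    proof -
      have f: "\<phi> r \<in> carrier R"
        using \<phi>(2) r by auto
      have "\<phi> (x \<otimes> \<phi> r) = \<phi> (y \<otimes> \<phi> r)"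
        using fun_cong[OF eq(2), of "\<phi> r"] r by simp
      then have "x \<otimes> \<phi> r \<ominus> y \<otimes> \<phi> r \<in> S"
        using \<phi>(4) x y f by blast
      moreover have "(x \<ominus> y) \<otimes> (r \<ominus> \<phi> r) \<in> S"
        using nonunital_subringD(2)[OF S xyS \<phi>(3)[OF r]] .
      ultimately have "(x \<ominus> y) \<otimes> (r \<ominus> \<phi> r) \<oplus> (x \<otimes> \<phi> r \<ominus> y \<otimes> \<phi> r) \<in> S"
        by blast
      moreover have "(x \<ominus> y) \<otimes> (r \<ominus> \<phi> r) \<oplus> (x \<otimes> \<phi> r \<ominus> y \<otimes> \<phi> r) = (x \<ominus> y) \<otimes> r"
        using x y r f by algebra
      ultimately show ?thesis by simp
    qed
    then show "x \<ominus> y \<in> P"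
      using xyS by (simp add: P_def)
  qed simp
  obtain \<theta> where \<theta>: "finite (\<theta> ` carrier R)" "\<theta> ` carrier R \<subseteq> carrier R"
    "\<And>x. x \<in> carrier R \<Longrightarrow> x \<ominus> \<theta> x \<in> P"
    "\<And>x y. \<lbrakk>x \<in> carrier R; y \<in> carrier R; \<theta> x = \<theta> y\<rbrakk> \<Longrightarrow> x \<ominus> y \<in> P"
    by (rule fin_cosets_carrierE[OF P_sub P_fin]) (rule that)
  define I where "I = {x \<in> carrier R. \<forall>r\<in>carrier R. r \<otimes> x \<in> P}"
  have "ideal I R"
  proof (rule idealI_minus)
    show "additive_subgroup I R"
    proof (rule additive_subgroupI_minus)
      show "\<zero> \<in> I"
        using P_sub by (auto simp: I_def additive_subgroup.zero_closed)
      fix x y assume xy: "x \<in> I" "y \<in> I"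
      have "r \<otimes> (x \<ominus> y) = r \<otimes> x \<ominus> r \<otimes> y" if "r \<in> carrier R" for r
        using that xy unfolding I_def by (elim CollectE conjE) algebra
      then show "x \<ominus> y \<in> I"
        using xy additive_subgroup_minus[OF P_sub] by (auto simp: I_def)
    qed (auto simp: I_def)
    fix a x assume a: "a \<in> I" "x \<in> carrier R"
    then have "r \<otimes> (x \<otimes> a) = (r \<otimes> x) \<otimes> a" "r \<otimes> (a \<otimes> x) = (r \<otimes> a) \<otimes> x" if "r \<in> carrier R" for r
      using that by (auto simp: I_def m_assoc)
    then show "x \<otimes> a \<in> I" "a \<otimes> x \<in> I"
      using a P_right by (auto simp: I_def)
  qed
  moreover have "I \<subseteq> S"
  proof
    fix x assume "x \<in> I"
    then have "x \<in> carrier R" "\<one> \<otimes> x \<in> P"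
      unfolding I_def using one_closed by blast+
    then show "x \<in> S"
      by (simp add: P_def)
  qed
  moreover have "fin_cosets (carrier R) I"
  proof (rule fin_cosets_of_finite_image)
    \<comment> \<open>No entry \<open>\<theta> s\<close> this time: \<open>P\<close> is a right
      ideal, so \<open>(r \<ominus> \<theta> r) \<otimes> (x \<ominus> y)\<close> lies in
      \<open>P\<close> for all ring elements \<open>x\<close> and \<open>y\<close>.\<close>
    let ?\<psi> = "\<lambda>s. \<lambda>f\<in>\<theta> ` carrier R. \<theta> (f \<otimes> s)"
    have "?\<psi> ` carrier R \<subseteq> (\<theta> ` carrier R \<rightarrow>\<^sub>E \<theta> ` carrier R)"
    proof
      fix z assume "z \<in> ?\<psi> ` carrier R"
      then obtain s where s: "s \<in> carrier R" "z = ?\<psi> s" by blast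
      have "\<theta> (f \<otimes> s) \<in> \<theta> ` carrier R" if "f \<in> \<theta> ` carrier R" for f
        using s(1) that \<theta>(2) by (intro imageI m_closed) auto
      then show "z \<in> \<theta> ` carrier R \<rightarrow>\<^sub>E \<theta> ` carrier R"
        using s by auto
    qed
    then show "finite (?\<psi> ` carrier R)"
      by (rule finite_subset) (simp add: finite_PiE \<theta>(1))
    fix x y assume x: "x \<in> carrier R" and y: "y \<in> carrier R" and eq: "?\<psi> x = ?\<psi> y"
    have "r \<otimes> (x \<ominus> y) \<in> P" if r: "r \<in> carrier R" for r
    proof -
      have f: "\<theta> r \<in> carrier R"
        using \<theta>(2) r by auto
      have "\<theta> (\<theta> r \<otimes> x) = \<theta> (\<theta> r \<otimes> y)"
        using fun_cong[OF eq, of "\<theta> r"] r by simp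
      then have "\<theta> r \<otimes> x \<ominus> \<theta> r \<otimes> y \<in> P"
        using \<theta>(4) x y f by blast
      moreover have "(r \<ominus> \<theta> r) \<otimes> (x \<ominus> y) \<in> P"
        using P_right[OF \<theta>(3)[OF r]] x y by blast
      ultimately have "(r \<ominus> \<theta> r) \<otimes> (x \<ominus> y) \<oplus> (\<theta> r \<otimes> x \<ominus> \<theta> r \<otimes> y) \<in> P"
        using additive_subgroup.a_closed[OF P_sub] by blast
      moreover have "(r \<ominus> \<theta> r) \<otimes> (x \<ominus> y) \<oplus> (\<theta> r \<otimes> x \<ominus> \<theta> r \<otimes> y) = r \<otimes> (x \<ominus> y)"
        using x y r f by algebra
      ultimately show ?thesis by simp
    qed
    then show "x \<ominus> y \<in> I"
      using x y by (simp add: I_def)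
  qed simp
  ultimately show ?thesis ..
qed

lemma finite_carrier_Quot:
  assumes I: "ideal I R" and fin: "fin_cosets (carrier R) I"
  shows "finite (carrier (R Quot I))"
proof -
  interpret I: ideal I R by (rule I)
  obtain F where F: "finite F" "F \<subseteq> carrier R" "\<And>x. x \<in> carrier R \<Longrightarrow> \<exists>f\<in>F. x \<ominus> f \<in> I"
    using fin by (auto simp: fin_cosets_def)
  have "carrier (R Quot I) \<subseteq> (\<lambda>f. I +> f) ` F"
  proof
    fix X assume "X \<in> carrier (R Quot I)"
    then obtain x where x: "x \<in> carrier R" "X = I +> x"
      by (auto simp: FactRing_def A_RCOSETS_def')
    then obtain f where f: "f \<in> F" "x \<ominus> f \<in> I"
      using F(3) by blast
    then have "x \<in> I +> f"
      using I.a_rcos_module_minus[OF ring_axioms] x(1) F(2) by blast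
    then have "X = I +> f"
      using I.a_repr_independence' x(2) f(1) F(2) by blast
    then show "X \<in> (\<lambda>f. I +> f) ` F"
      using f(1) by blast
  qed
  then show ?thesis
    by (rule finite_subset) (simp add: F(1))
qed

end

section \<open>The Jacobson radical of a finite ring\<close>

context ring
begin

lemma left_ideal_carrier: "left_ideal (carrier R) R"
  unfolding left_ideal_def by (auto intro!: additive_subgroupI_minus)

text \<open>With \<open>K = carrier R\<close> this makes the Jacobson radical a right ideal; for general \<open>K\<close> it is
  the simplicity of \<open>K/L\<close> that Nakayama's lemma needs.\<close>
lemma maximal_left_ideal_colon:
  assumes K: "left_ideal K R" and L: "left_ideal L R" "L \<subseteq> K"
    and max: "\<And>L'. \<lbrakk>left_ideal L' R; L \<subseteq> L'; L' \<subseteq> K\<rbrakk> \<Longrightarrow> L' = L \<or> L' = K"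
    and x: "x \<in> K" "x \<notin> L"
  shows "maximal_left_ideal {a \<in> carrier R. a \<otimes> x \<in> L} R"
proof -
  interpret K: additive_subgroup K R using K by (simp add: left_ideal_def)
  interpret L: additive_subgroup L R using L by (simp add: left_ideal_def)
  have Kl: "r \<otimes> y \<in> K" if "r \<in> carrier R" "y \<in> K" for r y
    using K that by (simp add: left_ideal_def)
  have Ll: "r \<otimes> y \<in> L" if "r \<in> carrier R" "y \<in> L" for r y
    using L that by (simp add: left_ideal_def)
  have xc: "x \<in> carrier R" using x(1) by (rule K.a_Hcarr)
  let ?M = "{a \<in> carrier R. a \<otimes> x \<in> L}"
  have "left_ideal ?M R"
    unfolding left_ideal_def
  proof (intro conjI ballI)
    show "additive_subgroup ?M R"
    proof (rule additive_subgroupI_minus)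
      fix a b assume ab: "a \<in> ?M" "b \<in> ?M"
      then have "a \<otimes> x \<ominus> b \<otimes> x \<in> L"
        using additive_subgroup_minus[OF L.additive_subgroup_axioms] by blast
      moreover have "(a \<ominus> b) \<otimes> x = a \<otimes> x \<ominus> b \<otimes> x"
        using ab xc by (elim CollectE conjE) algebra
      ultimately show "a \<ominus> b \<in> ?M"
        using ab by simp
    qed (use xc in auto)
    fix r a assume "r \<in> carrier R" "a \<in> ?M"
    then show "r \<otimes> a \<in> ?M"
      using Ll xc by (simp add: m_assoc)
  qed
  moreover have "?M \<noteq> carrier R"
    using x(2) xc one_closed by (metis (no_types, lifting) l_one mem_Collect_eq)
  moreover have "L' = carrier R" if L': "left_ideal L' R" "?M \<subseteq> L'" "L' \<noteq> ?M" for L'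
  proof -
    interpret L': additive_subgroup L' R using L'(1) by (simp add: left_ideal_def)
    obtain y where y: "y \<in> L'" "y \<notin> ?M"
      using L'(2,3) by blast
    \<comment> \<open>This is \<open>L' x + L\<close>. It lies between \<open>L\<close> and
      \<open>K\<close> and contains \<open>y \<otimes> x\<close>, which is not in \<open>L\<close>,
      so it must be \<open>K\<close>. Writing \<open>z \<otimes> x\<close> in this form then puts
      \<open>z\<close> in \<open>L'\<close>.\<close>
    define N where "N = {z. \<exists>a\<in>L'. \<exists>l\<in>L. z = a \<otimes> x \<oplus> l}"
    have "left_ideal N R"
      unfolding left_ideal_def
    proof (intro conjI ballI)
      show "additive_subgroup N R"
      proof (rule additive_subgroupI_minus)
        show "N \<subseteq> carrier R"
          using xc L'.a_Hcarr L.a_Hcarr by (auto simp: N_def)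
        show "\<zero> \<in> N"
          unfolding N_def using xc by (intro CollectI bexI[of _ \<zero>]) auto
        fix u v assume "u \<in> N" "v \<in> N"
        then obtain a l b m where *: "a \<in> L'" "l \<in> L" "b \<in> L'" "m \<in> L"
          "u = a \<otimes> x \<oplus> l" "v = b \<otimes> x \<oplus> m"
          by (auto simp: N_def)
        note c = L'.a_Hcarr[OF *(1)] L.a_Hcarr[OF *(2)] L'.a_Hcarr[OF *(3)] L.a_Hcarr[OF *(4)]
        have "u \<ominus> v = (a \<ominus> b) \<otimes> x \<oplus> (l \<ominus> m)"
          unfolding *(5,6) using xc c by algebra
        moreover have "a \<ominus> b \<in> L'" "l \<ominus> m \<in> L"
          using * additive_subgroup_minus L.additive_subgroup_axioms L'.additive_subgroup_axioms by auto
        ultimately show "u \<ominus> v \<in> N"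
          unfolding N_def by blast
      qed
      fix r u assume r: "r \<in> carrier R" and "u \<in> N"
      then obtain a l where *: "a \<in> L'" "l \<in> L" "u = a \<otimes> x \<oplus> l"
        by (auto simp: N_def)
      then have "r \<otimes> u = (r \<otimes> a) \<otimes> x \<oplus> r \<otimes> l"
        using xc r L'.a_Hcarr[OF *(1)] L.a_Hcarr[OF *(2)] by algebra
      moreover have "r \<otimes> a \<in> L'"
        using L'(1) r * by (simp add: left_ideal_def)
      ultimately show "r \<otimes> u \<in> N"
        using Ll r * unfolding N_def by blast
    qed
    moreover have "L \<subseteq> N"
    proof
      fix l assume "l \<in> L"
      then show "l \<in> N"
        unfolding N_def using xc L.a_Hcarr by (intro CollectI bexI[of _ \<zero>] bexI[of _ l]) auto
    qed
    moreover have "N \<subseteq> K"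
    proof
      fix z assume "z \<in> N"
      then obtain a l where "a \<in> L'" "l \<in> L" "z = a \<otimes> x \<oplus> l"
        by (auto simp: N_def)
      then show "z \<in> K"
        using Kl[OF L'.a_Hcarr x(1)] L(2) by blast
    qed
    ultimately have "N = L \<or> N = K"
      using max by blast
    moreover have "y \<otimes> x \<in> N"
      unfolding N_def using y(1) xc L'.a_Hcarr
      by (intro CollectI bexI[of _ y] bexI[of _ \<zero>]) auto
    moreover have "y \<otimes> x \<notin> L"
      using y L'.a_Hcarr by blast
    ultimately have NK: "N = K"
      by blast
    have "carrier R \<subseteq> L'"
    proof
      fix z assume z: "z \<in> carrier R"
      then have "z \<otimes> x \<in> N"
        unfolding NK using Kl x(1) by blast
      then obtain a l where *: "a \<in> L'" "l \<in> L" "z \<otimes> x = a \<otimes> x \<oplus> l"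
        by (auto simp: N_def)
      note c = L'.a_Hcarr[OF *(1)] L.a_Hcarr[OF *(2)]
      have "(z \<ominus> a) \<otimes> x = z \<otimes> x \<ominus> a \<otimes> x"
        using z xc c by algebra
      also have "\<dots> = l"
        unfolding *(3) using xc c by algebra
      finally have "z \<ominus> a \<in> ?M"
        using z c *(2) by simp
      then have "z \<ominus> a \<oplus> a \<in> L'"
        using L'(2) *(1) by blast
      moreover have "z \<ominus> a \<oplus> a = z"
        using z c by algebra
      ultimately show "z \<in> L'" by simp
    qed
    then show ?thesis
      using L'.a_subset by blast
  qed
  ultimately show ?thesis
    unfolding maximal_left_ideal_def by blast
qed

lemma ideal_jacobson_radical: "ideal (jacobson_radical R) R"
proof (rule idealI_minus)
  let ?J = "jacobson_radical R"
  have J: "x \<in> ?J \<longleftrightarrow> x \<in> carrier R \<and> (\<forall>L. maximal_left_ideal L R \<longrightarrow> x \<in> L)" for x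
    by (auto simp: jacobson_radical_def)
  have sub: "additive_subgroup L R" if "maximal_left_ideal L R" for L
    using that by (simp add: maximal_left_ideal_def left_ideal_def)
  show "additive_subgroup ?J R"
  proof (rule additive_subgroupI_minus)
    show "\<zero> \<in> ?J"
      unfolding J using sub additive_subgroup.zero_closed by blast
    show "x \<ominus> y \<in> ?J" if "x \<in> ?J" "y \<in> ?J" for x y
      using that unfolding J by (auto intro: additive_subgroup_minus[OF sub])
  qed (auto simp: J)
  fix a x assume a: "a \<in> ?J" and x: "x \<in> carrier R"
  show "x \<otimes> a \<in> ?J"
    using a x unfolding J by (auto simp: maximal_left_ideal_def left_ideal_def)
  show "a \<otimes> x \<in> ?J"
    unfolding J
  proof (intro conjI allI impI)
    show "a \<otimes> x \<in> carrier R"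
      using a x by (simp add: J)
    fix L assume L: "maximal_left_ideal L R"
    show "a \<otimes> x \<in> L"
    proof (cases "x \<in> L")
      case True
      then show ?thesis
        using L a by (simp add: J maximal_left_ideal_def left_ideal_def)
    next
      case False
      have "maximal_left_ideal {a \<in> carrier R. a \<otimes> x \<in> L} R"
      proof (rule maximal_left_ideal_colon[OF left_ideal_carrier _ _ _ x False])
        show "left_ideal L R"
          using L by (simp add: maximal_left_ideal_def)
        show "L \<subseteq> carrier R"
          using sub[OF L] additive_subgroup.a_subset by blast
        show "L' = L \<or> L' = carrier R" if "left_ideal L' R" "L \<subseteq> L'" for L'
          using L that by (simp add: maximal_left_ideal_def)
      qed
      then have "a \<in> {a \<in> carrier R. a \<otimes> x \<in> L}"
        using a unfolding J by blast
      then show ?thesis by blast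
    qed
  qed
qed

lemma left_ideal_zero: "left_ideal {\<zero>} R"
  unfolding left_ideal_def by (auto intro!: additive_subgroupI_minus simp: minus_eq)

text \<open>Nakayama's lemma for finite \<open>K\<close>. Finiteness provides a left ideal
  \<open>L\<close> maximal among those strictly inside \<open>K\<close>; the radical annihilates the
  simple quotient \<open>K/L\<close>, so the product stays inside \<open>L\<close>.\<close>

lemma jacobson_radical_prod_neq:
  assumes K: "left_ideal K R" "finite K" "K \<noteq> {\<zero>}"
  shows "jacobson_radical R \<cdot> K \<noteq> K"
proof -
  let ?\<L> = "{L. left_ideal L R \<and> L \<subset> K}"
  have Ksub: "additive_subgroup K R"
    using K by (simp add: left_ideal_def)
  have fin: "finite ?\<L>"
    by (rule finite_subset[of _ "Pow K"]) (use K in auto)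
  have zero: "{\<zero>} \<in> ?\<L>"
    using K(3) left_ideal_zero additive_subgroup.zero_closed[OF Ksub] by auto
  obtain L where L: "L \<in> ?\<L>" "\<And>L'. \<lbrakk>L' \<in> ?\<L>; L \<subseteq> L'\<rbrakk> \<Longrightarrow> L = L'"
    using finite_has_maximal2[OF fin zero] by metis
  interpret L: additive_subgroup L R
    using L(1) by (simp add: left_ideal_def)
  have JK: "j \<otimes> x \<in> L" if j: "j \<in> jacobson_radical R" and x: "x \<in> K" for j x
  proof (cases "x \<in> L")
    case True
    then show ?thesis
      using j L(1) by (auto simp: left_ideal_def jacobson_radical_def)
  next
    case False
    have "maximal_left_ideal {a \<in> carrier R. a \<otimes> x \<in> L} R"
      by (rule maximal_left_ideal_colon[OF K(1) _ _ _ x False]) (use L in blast)+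
    then show ?thesis
      using j unfolding jacobson_radical_def by blast
  qed
  have "y \<in> L" if "y \<in> jacobson_radical R \<cdot> K" for y
    using that by (induction rule: ideal_prod.induct) (auto intro: JK)
  then show ?thesis
    using L(1) by blast
qed

text \<open>New factors enter on the left, the side on which Nakayama's lemma applies to the left
  ideal \<open>rad_power n\<close>.\<close>

definition rad_power :: "nat \<Rightarrow> 'a set" where
  "rad_power n = ((\<lambda>K. jacobson_radical R \<cdot> K) ^^ n) (carrier R)"

lemma rad_power_simps [simp]:
  "rad_power 0 = carrier R"
  "rad_power (Suc n) = jacobson_radical R \<cdot> rad_power n"
  by (simp_all add: rad_power_def)

lemma ideal_rad_power: "ideal (rad_power n) R"
  by (induction n) (simp_all add: oneideal ideal_prod_is_ideal ideal_jacobson_radical)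

lemma rad_power_1: "rad_power (Suc 0) = jacobson_radical R"
  by (simp add: ideal_prod_one ideal_jacobson_radical)

lemma rad_power_Suc_subset: "rad_power (Suc n) \<subseteq> rad_power n" "rad_power (Suc n) \<subseteq> jacobson_radical R"
  using ideal_prod_inter[OF ideal_jacobson_radical ideal_rad_power] by auto

text \<open>The new factor on the right is passed inwards by associativity: a generator
  \<open>i \<otimes> j\<close> times \<open>y\<close> is \<open>i \<otimes> (j \<otimes> y)\<close>,
  and the induction hypothesis applies to \<open>j \<otimes> y\<close>.\<close>

lemma rad_power_mult_closed:
  assumes "x \<in> rad_power n" "y \<in> jacobson_radical R"
  shows "x \<otimes> y \<in> rad_power (Suc n)"
  using assms(1)
proof (induction n arbitrary: x)
  case 0
  then show ?case
    using assms(2) ideal.I_l_closed[OF ideal_jacobson_radical] unfolding rad_power_1 by simp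
next
  case (Suc n)
  have yc: "y \<in> carrier R"
    using assms(2) by (simp add: jacobson_radical_def)
  from Suc.prems have "x \<in> jacobson_radical R \<cdot> rad_power n" by simp
  \<comment> \<open>Membership in the carrier is carried along because distributivity needs it at
    sums.\<close>
  then have "x \<in> carrier R \<and> x \<otimes> y \<in> jacobson_radical R \<cdot> rad_power (Suc n)"
  proof (induction rule: ideal_prod.induct)
    case (prod i j)
    have "i \<in> carrier R" "j \<in> carrier R"
      using prod ideal.Icarr[OF ideal_rad_power] by (auto simp: jacobson_radical_def)
    then show ?case
      using ideal_prod.prod[OF prod(1) Suc.IH[OF prod(2)]] yc by (simp add: m_assoc)
  next
    case (sum u v)
    then show ?case
      using yc by (simp add: l_distr ideal_prod.sum)
  qed
  then show ?case by simp
qed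

text \<open>By Nakayama's lemma each nonzero power strictly contains the next, so a chain that never
  reached zero would have to lose more than \<open>card (carrier R)\<close> elements.\<close>

lemma rad_power_eq_zero:
  assumes fin: "finite (carrier R)"
  obtains n where "rad_power n = {\<zero>}"
proof -
  have "\<exists>n. rad_power n = {\<zero>}"
  proof (rule ccontr)
    assume *: "\<nexists>n. rad_power n = {\<zero>}"
    have finp: "finite (rad_power n)" for n
      using fin ideal.Icarr[OF ideal_rad_power] by (meson finite_subset subsetI)
    have less: "card (rad_power (Suc n)) < card (rad_power n)" for n
    proof (rule psubset_card_mono[OF finp])
      interpret I: ideal "rad_power n" R by (rule ideal_rad_power)
      have "left_ideal (rad_power n) R"
        unfolding left_ideal_def using I.additive_subgroup_axioms I.I_l_closed by simp
      then have "rad_power (Suc n) \<noteq> rad_power n"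
        using jacobson_radical_prod_neq finp * by simp
      then show "rad_power (Suc n) \<subset> rad_power n"
        using rad_power_Suc_subset by blast
    qed
    have "card (rad_power n) + n \<le> card (carrier R)" for n
    proof (induction n)
      case (Suc n)
      then show ?case using less[of n] by linarith
    qed simp
    from this[of "Suc (card (carrier R))"] show False by linarith
  qed
  then show ?thesis using that by blast
qed

text \<open>
  Let \<open>K\<close> be the last nonzero power of \<open>J\<close>, so that \<open>J K = K J = 0\<close>. If \<open>S + K\<close> is everything,
  then elements of \<open>J\<close> may be changed modulo \<open>K\<close> into elements of \<open>S \<inter> J\<close> without affecting
  products of two of them, and therefore \<open>K \<subseteq> J\<^sup>2 \<subseteq> S\<close>.
\<close>
lemma jacobson_square_nonzero:
  assumes fin: "finite (carrier R)"
    and sq: "jacobson_radical R \<cdot> jacobson_radical R \<noteq> {\<zero>}"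
  obtains K where "ideal K R" "K \<noteq> {\<zero>}"
    "\<And>S. \<lbrakk>nonunital_subring S R; S <+> K = carrier R\<rbrakk> \<Longrightarrow> S = carrier R"
proof -
  let ?J = "jacobson_radical R"
  obtain n where "rad_power n = {\<zero>}"
    using rad_power_eq_zero[OF fin] .
  define N where "N = (LEAST n. rad_power n = {\<zero>})"
  have N: "rad_power N = {\<zero>}" "\<And>m. m < N \<Longrightarrow> rad_power m \<noteq> {\<zero>}"
    unfolding N_def using LeastI[of "\<lambda>n. rad_power n = {\<zero>}", OF \<open>rad_power n = {\<zero>}\<close>] not_less_Least
    by auto
  have zero: "rad_power (Suc m) = {\<zero>}" if "rad_power m = {\<zero>}" for m
    using that by (simp add: ideal_prod_zero[OF ideal_jacobson_radical])
  have two: "rad_power (Suc (Suc 0)) \<noteq> {\<zero>}"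
    using sq rad_power_1 by (simp del: rad_power_simps(1))
  \<comment> \<open>Powers stay zero once they are zero, so a nonzero square forces \<open>N\<close>
    to be at least 3. Hence \<open>K\<close>, the power before, is \<open>J\<close> times a power
    contained in \<open>J\<close>, and its elements are sums of products of two elements of
    \<open>J\<close>.\<close>
  have "N \<noteq> 0" "N \<noteq> Suc 0" "N \<noteq> Suc (Suc 0)"
    using two zero N(1) by metis+
  then obtain m where m: "N = Suc (Suc (Suc m))"
    by (metis not0_implies_Suc)
  define K where "K = rad_power (Suc (Suc m))"
  have K: "ideal K R" "K \<noteq> {\<zero>}"
    unfolding K_def by (rule ideal_rad_power, rule N(2), simp only: m)
  interpret K: ideal K R by (rule K(1))
  interpret J: ideal ?J R by (rule ideal_jacobson_radical)
  have KJ: "k \<otimes> j = \<zero>" if "k \<in> K" "j \<in> ?J" for k j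
    using rad_power_mult_closed[OF that[unfolded K_def]] N(1) m by simp
  have JK: "j \<otimes> k = \<zero>" if "k \<in> K" "j \<in> ?J" for k j
    using ideal_prod.prod[OF that(2) that(1)[unfolded K_def], of R] N(1) m by simp
  have KJsub: "K \<subseteq> ?J"
    unfolding K_def by (rule rad_power_Suc_subset(2))
  have "S = carrier R" if S: "nonunital_subring S R" and SK: "S <+> K = carrier R" for S
  proof -
    interpret S: additive_subgroup S R by (rule nonunital_subringD(1)[OF S])
    have dec: "\<exists>s\<in>S \<inter> ?J. \<exists>k\<in>K. j = s \<oplus> k" if j: "j \<in> ?J" for j
    proof -
      have "j \<in> S <+> K"
        using J.Icarr[OF j] SK by simp
      then obtain s k where *: "s \<in> S" "k \<in> K" "j = s \<oplus> k"
        unfolding mem_set_add_iff by blast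
      have "s = j \<ominus> k"
        unfolding *(3) using S.a_Hcarr[OF *(1)] K.a_Hcarr[OF *(2)] by algebra
      then have "s \<in> ?J"
        using additive_subgroup_minus[OF J.additive_subgroup_axioms j] * KJsub by blast
      then show ?thesis
        using * by blast
    qed
    have "i \<otimes> j \<in> S" if i: "i \<in> ?J" and j: "j \<in> ?J" for i j
    proof -
      obtain s k where s: "s \<in> S" "s \<in> ?J" "k \<in> K" "i = s \<oplus> k"
        using dec[OF i] by blast
      obtain t l where t: "t \<in> S" "t \<in> ?J" "l \<in> K" "j = t \<oplus> l"
        using dec[OF j] by blast
      note c = S.a_Hcarr[OF s(1)] K.a_Hcarr[OF s(3)] S.a_Hcarr[OF t(1)] K.a_Hcarr[OF t(3)]
      have "i \<otimes> j = s \<otimes> t \<oplus> (s \<otimes> l \<oplus> k \<otimes> j)"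
        unfolding s(4) t(4) using c by algebra
      also have "\<dots> = s \<otimes> t"
        using JK[OF t(3) s(2)] KJ[OF s(3) j] c by simp
      finally show ?thesis
        using nonunital_subringD(2)[OF S s(1) t(1)] by simp
    qed
    then have gen: "i \<otimes> j \<in> S" if "i \<in> ?J" "j \<in> rad_power (Suc m)" for i j
      using that rad_power_Suc_subset(2) by blast
    have "x \<in> S" if "x \<in> K" for x
    proof -
      have "x \<in> ?J \<cdot> rad_power (Suc m)"
        using that by (simp add: K_def)
      then show ?thesis
        by (induction rule: ideal_prod.induct) (use gen in auto)
    qed
    then have "S <+> K \<subseteq> S"
      by (auto simp: mem_set_add_iff)
    then show ?thesis
      using SK S.a_subset by blast
  qed
  then show ?thesis
    using that K by blast
qed

end

section \<open>The characteristic\<close>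

context ring
begin

text \<open>If neither enlarged family covers, the Chinese remainder theorem merges the two uncovered
  elements into a single one.\<close>
lemma ring_cover_enlarged_comaximal:
  assumes C: "ring_cover R C" and K: "ideal K R" and L: "ideal L R"
    and comax: "P \<in> K" "Q \<in> L" "P \<ominus> Q = \<one>"
    and both: "\<And>S. \<lbrakk>S \<in> C; S <+> K = carrier R; S <+> L = carrier R\<rbrakk> \<Longrightarrow> S = carrier R"
  shows "ring_cover R (enlarged C K) \<or> ring_cover R (enlarged C L)"
proof (rule ccontr)
  interpret K: ideal K R by (rule K)
  interpret L: ideal L R by (rule L)
  assume "\<not> ?thesis"
  then obtain x y where x: "x \<in> carrier R" "x \<notin> \<Union>(enlarged C K)"
    and y: "y \<in> carrier R" "y \<notin> \<Union>(enlarged C L)"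
    unfolding ring_cover_enlarged_iff[OF C K] ring_cover_enlarged_iff[OF C L] by blast
  have PQ: "P \<in> carrier R" "Q \<in> carrier R"
    using comax by auto
  \<comment> \<open>Modulo \<open>K\<close> one has \<open>P = 0\<close> and \<open>Q = -1\<close>,
    so \<open>z\<close> is \<open>x\<close>; modulo \<open>L\<close> one has \<open>Q = 0\<close>
    and \<open>P = 1\<close>, so \<open>z\<close> is \<open>y\<close>.\<close>
  define z where "z = P \<otimes> y \<ominus> Q \<otimes> x"
  have "z \<in> carrier R"
    unfolding z_def using PQ x(1) y(1) by simp
  then obtain S where S: "S \<in> C" "z \<in> S"
    using C unfolding ring_cover_def by blast
  have P: "P = \<one> \<oplus> Q"
    unfolding comax(3)[symmetric] using PQ by algebra
  have "x = z \<oplus> P \<otimes> (x \<ominus> y)" "y = z \<oplus> Q \<otimes> (x \<ominus> y)"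
    unfolding z_def P using PQ(2) x(1) y(1) by algebra+
  moreover have "P \<otimes> (x \<ominus> y) \<in> K" "Q \<otimes> (x \<ominus> y) \<in> L"
    using comax x(1) y(1) K.I_r_closed L.I_r_closed by auto
  ultimately have "x \<in> S <+> K" "y \<in> S <+> L"
    using S(2) unfolding mem_set_add_iff by blast+
  then have "S <+> K = carrier R" "S <+> L = carrier R"
    using x(2) y(2) S(1) unfolding enlarged_def by blast+
  then show False
    using both S(1) C unfolding ring_cover_def by blast
qed

definition multiples :: "nat \<Rightarrow> 'a set" where
  "multiples n = (\<lambda>x. [n] \<cdot> x) ` carrier R"

lemma ideal_multiples: "ideal (multiples n) R"
proof (rule idealI_minus)
  show "additive_subgroup (multiples n) R"
  proof (rule additive_subgroupI_minus)
    show "\<zero> \<in> multiples n"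
      unfolding multiples_def by (rule image_eqI[of _ _ \<zero>]) auto
    fix u v assume "u \<in> multiples n" "v \<in> multiples n"
    then obtain x y where *: "x \<in> carrier R" "y \<in> carrier R" "u = [n] \<cdot> x" "v = [n] \<cdot> y"
      by (auto simp: multiples_def)
    have "[n] \<cdot> (x \<ominus> y) \<oplus> [n] \<cdot> y = [n] \<cdot> (x \<ominus> y \<oplus> y)"
      using * by (simp add: add.nat_pow_distrib)
    also have "x \<ominus> y \<oplus> y = x"
      using *(1,2) by algebra
    finally have "u = [n] \<cdot> (x \<ominus> y) \<oplus> v"
      using * by simp
    moreover have "[n] \<cdot> (x \<ominus> y) \<in> carrier R" "v \<in> carrier R"
      using * by simp_all
    ultimately have "u \<ominus> v = [n] \<cdot> (x \<ominus> y)"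
      by algebra
    then show "u \<ominus> v \<in> multiples n"
      using *(1,2) by (simp add: multiples_def)
  qed (auto simp: multiples_def)
qed (auto simp: multiples_def add_pow_ldistr add_pow_rdistr)

lemma add_pow_eq_zero:
  assumes "[(n::nat)] \<cdot> \<one> = \<zero>" "n dvd k" "x \<in> carrier R"
  shows "[k] \<cdot> x = \<zero>"
proof -
  have "[n] \<cdot> x = ([n] \<cdot> \<one>) \<otimes> x"
    using assms(3) by (simp add: add_pow_ldistr)
  also have "\<dots> = \<zero>"
    using assms(1,3) by simp
  finally show ?thesis
    using assms(2,3) by (auto simp flip: add.nat_pow_pow)
qed

lemma add_pow_closed_subgroup:
  assumes "additive_subgroup H R" "x \<in> H"
  shows "[(n::nat)] \<cdot> x \<in> H"
  using assms by (induction n) (auto simp: additive_subgroup.zero_closed additive_subgroup.a_closed)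

text \<open>Substitute one decomposition into the other: \<open>x = s + a y\<close> and
  \<open>y = t + b z\<close> give \<open>x = s + a t + ab z\<close>, and the last term vanishes.
  Both \<open>a = b\<close> and coprime \<open>a\<close>, \<open>b\<close> occur later.\<close>

lemma set_add_multiples_eq_carrier:
  assumes S: "nonunital_subring S R"
    and "S <+> multiples a = carrier R" "S <+> multiples b = carrier R"
    and ab: "[(a * b)] \<cdot> \<one> = \<zero>"
  shows "S = carrier R"
proof -
  interpret S: additive_subgroup S R by (rule nonunital_subringD(1)[OF S])
  have dec: "\<exists>s\<in>S. \<exists>y\<in>carrier R. x = s \<oplus> [k] \<cdot> y"
    if "S <+> multiples k = carrier R" "x \<in> carrier R" for x k
  proof -
    have "x \<in> S <+> multiples k"
      using that by simp
    then show ?thesis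
      unfolding mem_set_add_iff multiples_def by blast
  qed
  have "carrier R \<subseteq> S"
  proof
    fix x assume "x \<in> carrier R"
    then obtain s y where s: "s \<in> S" "y \<in> carrier R" "x = s \<oplus> [a] \<cdot> y"
      using dec[OF assms(2)] by blast
    obtain t z where t: "t \<in> S" "z \<in> carrier R" "y = t \<oplus> [b] \<cdot> z"
      using dec[OF assms(3) s(2)] by blast
    have "[a] \<cdot> ([b] \<cdot> z) = \<zero>"
      using add_pow_eq_zero[OF ab _ t(2), of "b * a"] t(2) by (simp add: add.nat_pow_pow mult.commute)
    then have "[a] \<cdot> y = [a] \<cdot> t"
      unfolding t(3) using t(2) S.a_Hcarr[OF t(1)] by (simp add: add.nat_pow_distrib)
    then show "x \<in> S"
      unfolding s(3) using s(1) add_pow_closed_subgroup[OF S.additive_subgroup_axioms t(1)] by simp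
  qed
  then show ?thesis
    using S.a_subset by blast
qed

lemma finite_ring_add_pow_eq_zero:
  assumes "finite (carrier R)"
  shows "\<exists>n::nat. n > 0 \<and> [n] \<cdot> \<one> = \<zero>"
proof -
  have "\<not> inj (\<lambda>k::nat. [k] \<cdot> \<one>)"
  proof
    assume "inj (\<lambda>k::nat. [k] \<cdot> \<one>)"
    moreover have "finite (range (\<lambda>k::nat. [k] \<cdot> \<one>))"
      by (rule finite_subset[OF _ assms]) auto
    ultimately show False
      using finite_imageD infinite_UNIV_nat by blast
  qed
  then obtain i j :: nat where ij: "i < j" "[i] \<cdot> \<one> = [j] \<cdot> \<one>"
    unfolding inj_def by (metis linorder_neqE_nat)
  have "[i] \<cdot> \<one> \<oplus> [(j - i)] \<cdot> \<one> = [j] \<cdot> \<one>"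
    using ij(1) by (simp add: add.nat_pow_mult)
  then have "[i] \<cdot> \<one> \<oplus> [(j - i)] \<cdot> \<one> = [i] \<cdot> \<one> \<oplus> \<zero>"
    by (simp add: ij(2))
  then have "[(j - i)] \<cdot> \<one> = \<zero>"
    by (subst (asm) add.Units_l_cancel) simp_all
  then show ?thesis
    using ij(1) by (intro exI[of _ "j - i"]) simp
qed

text \<open>Let the characteristic be \<open>n = p m\<close> with \<open>p\<close> prime. As
  \<open>n\<close> is not prime, \<open>m > 1\<close>, and both \<open>multiples p\<close> and
  \<open>multiples m\<close> are nonzero. If \<open>p\<close> divides \<open>m\<close>, then
  \<open>n\<close> divides \<open>m * m\<close>, and \<open>multiples m\<close> loses no member of
  the cover. Otherwise the two ideals are comaximal, and one of them works, without it being known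
  which.\<close>

lemma characteristic_not_prime:
  assumes fin: "finite (carrier R)" and C: "ring_cover R C"
    and np: "\<not> Factorial_Ring.prime (ring_characteristic R)"
  obtains K where "ideal K R" "K \<noteq> {\<zero>}" "ring_cover R (enlarged C K)"
proof -
  let ?P = "\<lambda>n::nat. n > 0 \<and> [n] \<cdot> \<one> = \<zero>"
  define n where "n = ring_characteristic R"
  have n_def': "n = (LEAST n. ?P n)"
    using finite_ring_add_pow_eq_zero[OF fin] by (simp add: n_def ring_characteristic_def)
  have n: "n > 0" "[n] \<cdot> \<one> = \<zero>" "\<And>k. \<lbrakk>k > 0; k < n\<rbrakk> \<Longrightarrow> [k] \<cdot> \<one> \<noteq> \<zero>"
    unfolding n_def' using LeastI_ex[OF finite_ring_add_pow_eq_zero[OF fin]] not_less_Least[of _ ?P]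
    by blast+
  \<comment> \<open>The zero ring has no cover: a member containing \<open>\<zero>\<close> would
    already be everything.\<close>
  have "n \<noteq> 1"
  proof
    assume "n = 1"
    then have "\<one> = \<zero>"
      using n(2) by simp
    then have "carrier R = {\<zero>}"
      using one_zeroD by blast
    moreover obtain S where S: "S \<in> C" "\<zero> \<in> S"
      using C unfolding ring_cover_def by blast
    moreover have "S \<subseteq> carrier R"
      using S C unfolding ring_cover_def by blast
    ultimately have "S = carrier R" by auto
    then show False
      using S C unfolding ring_cover_def by blast
  qed
  then obtain p where p: "Factorial_Ring.prime p" "p dvd n"
    using prime_factor_nat by blast
  then obtain m where m: "n = p * m"
    by (auto elim: dvdE)
  have m1: "m \<noteq> 1" "m > 0"
    using m np p(1) n(1) by (auto simp: n_def intro: Nat.gr0I)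
  have p1: "p > 1"
    using p(1) by (rule prime_gt_1_nat)
  have nonzero: "multiples k \<noteq> {\<zero>}" if "0 < k" "k < n" for k
    using n(3)[OF that] by (auto simp: multiples_def)
  have sub: "nonunital_subring S R" if "S \<in> C" for S
    using C that by (simp add: ring_cover_def)
  have mn: "m < n" and pn: "p < n"
    using m m1 p1 by (auto simp: n_less_m_mult_n n_less_n_mult_m)
  show ?thesis
  proof (cases "p dvd m")
    case True
    then have "n dvd m * m"
      unfolding m by (simp add: mult_dvd_mono)
    then have "[(m * m)] \<cdot> \<one> = \<zero>"
      using add_pow_eq_zero[OF n(2)] by blast
    then have "ring_cover R (enlarged C (multiples m))"
      using ring_cover_enlargedI[OF C ideal_multiples] set_add_multiples_eq_carrier sub by metis
    then show ?thesis
      using that ideal_multiples nonzero[OF m1(2) mn] by blast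
  next
    case False
    then have "coprime p m"
      using p(1) prime_imp_coprime by blast
    \<comment> \<open>Bezout without negative coefficients, so that natural multiples of
      \<open>\<one>\<close> supply the two elements with difference \<open>\<one>\<close>.\<close>
    then obtain a b where ab: "p * a = m * b + 1"
      using coprime_bezout_strong[of p m] m1(1) by auto
    have PQ: "[(p * a)] \<cdot> \<one> \<ominus> [(m * b)] \<cdot> \<one> = \<one>"
    proof -
      have "[(p * a)] \<cdot> \<one> = [(m * b)] \<cdot> \<one> \<oplus> \<one>"
        unfolding ab by (simp flip: add.nat_pow_mult)
      moreover have "[(m * b)] \<cdot> \<one> \<in> carrier R"
        by simp
      ultimately show ?thesis
        using one_closed by algebra
    qed
    have mem: "[(p * a)] \<cdot> \<one> \<in> multiples p" "[(m * b)] \<cdot> \<one> \<in> multiples m"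
      unfolding multiples_def by (simp_all add: mult.commute[of _ a] mult.commute[of _ b] flip: add.nat_pow_pow)
    have "S = carrier R"
      if "S \<in> C" "S <+> multiples p = carrier R" "S <+> multiples m = carrier R" for S
      using set_add_multiples_eq_carrier[OF sub[OF that(1)] that(2,3)] n(2) m by blast
    then have "ring_cover R (enlarged C (multiples p)) \<or> ring_cover R (enlarged C (multiples m))"
      by (rule ring_cover_enlarged_comaximal[OF C ideal_multiples ideal_multiples mem PQ])
    moreover have "0 < p"
      using p1 by simp
    ultimately show ?thesis
      using that[OF ideal_multiples] nonzero[OF m1(2) mn] nonzero[OF _ pn] by blast
  qed
qed

end

section \<open>Passing to a maximal quotient\<close>

lemma (in ideal) mem_iff_coset_eq_zero:
  assumes "x \<in> carrier R"
  shows "I +> x = \<zero>\<^bsub>R Quot I\<^esub> \<longleftrightarrow> x \<in> I"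
  using assms a_rcos_self a_coset_join2 a_subgroup by (auto simp: FactRing_def)

lemma (in ideal) carrier_Quot_eq: "carrier (R Quot I) = (+>) I ` carrier R"
  by (auto simp: FactRing_def A_RCOSETS_def')

text \<open>An ideal above \<open>I\<close> is the union of the cosets of \<open>I\<close> it
  contains, hence determined by a subset of the finite quotient.\<close>

lemma (in ring) finite_ideals_above:
  assumes I: "ideal I R" and fin: "finite (carrier (R Quot I))"
  shows "finite {K. ideal K R \<and> I \<subseteq> K}"
proof (rule finite_subset)
  interpret I: ideal I R by (rule I)
  show "{K. ideal K R \<and> I \<subseteq> K} \<subseteq> Union ` Pow (carrier (R Quot I))"
  proof
    fix K assume "K \<in> {K. ideal K R \<and> I \<subseteq> K}"
    then have K: "ideal K R" and IK: "I \<subseteq> K" by auto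
    interpret K: ideal K R by (rule K)
    have "K = \<Union>((+>) I ` K)"
    proof
      show "K \<subseteq> \<Union>((+>) I ` K)"
        using I.a_rcos_self K.a_Hcarr by blast
      show "\<Union>((+>) I ` K) \<subseteq> K"
        using IK by (auto simp: a_r_coset_def')
    qed
    moreover have "(+>) I ` K \<in> Pow (carrier (R Quot I))"
      unfolding I.carrier_Quot_eq using K.a_Hcarr by blast
    ultimately show "K \<in> Union ` Pow (carrier (R Quot I))"
      by blast
  qed
qed (simp add: fin)

lemma (in ring) finite_irredundant_cover_ideal:
  assumes C: "ring_cover R C" "finite C" and irr: "\<And>T. T \<in> C \<Longrightarrow> \<not> ring_cover R (C - {T})"
  obtains I where "ideal I R" "\<And>T. T \<in> C \<Longrightarrow> I \<subseteq> T" "fin_cosets (carrier R) I"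
proof -
  have T: "nonunital_subring T R" "T \<noteq> carrier R" if "T \<in> C" for T
    using C(1) that by (auto simp: ring_cover_def)
  note sub = nonunital_subringD(1)[OF T(1)]
  have U: "\<Union>C = carrier R"
    using C(1) by (simp add: ring_cover_def)
  let ?D = "carrier R \<inter> \<Inter>C"
  have "\<Union>(C - {T}) \<noteq> carrier R" if "T \<in> C" for T
    using irr[OF that] C(1) by (auto simp: ring_cover_def)
  \<comment> \<open>The empty subfamily gives the whole ring, since the intersection with
    \<open>carrier R\<close> cuts down \<open>\<Inter>{} = UNIV\<close>.\<close>
  then have "fin_cosets (carrier R \<inter> \<Inter>{}) ?D"
    by (intro fin_cosets_Inter_irredundant_cover C(2) sub U) auto
  then have fin: "fin_cosets (carrier R) ?D"
    by simp
  have "nonunital_subring ?D R"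
    unfolding nonunital_subring_def
  proof (intro conjI ballI)
    show "additive_subgroup ?D R"
    proof (rule additive_subgroupI_minus)
      show "\<zero> \<in> ?D"
        using sub additive_subgroup.zero_closed by fastforce
      show "x \<ominus> y \<in> ?D" if "x \<in> ?D" "y \<in> ?D" for x y
        using that additive_subgroup_minus[OF sub] by auto
    qed simp
    show "x \<otimes> y \<in> ?D" if "x \<in> ?D" "y \<in> ?D" for x y
      using that nonunital_subringD(2)[OF T(1)] by auto
  qed
  then obtain I where "ideal I R" "I \<subseteq> ?D" "fin_cosets (carrier R) I"
    using ideal_in_subring_of_finite_index fin by blast
  then show ?thesis
    using that by blast
qed

text \<open>The size of a cover is only bounded from above, because enlarging may drop or merge
  members and must lead to an admissible cover again. When \<open>C0\<close> is minimal, equality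
  follows.\<close>

lemma (in ring) maximal_ideal_below_cover:
  assumes C0: "ring_cover R C0" "finite C0" and irr: "\<And>T. T \<in> C0 \<Longrightarrow> \<not> ring_cover R (C0 - {T})"
  obtains I C where "ideal I R" "finite (carrier (R Quot I))"
    "ring_cover R C" "finite C" "card C \<le> card C0" "\<And>T. T \<in> C \<Longrightarrow> I \<subseteq> T"
    "\<And>K D. \<lbrakk>ideal K R; I \<subseteq> K; ring_cover R D; finite D; card D \<le> card C0; \<forall>T\<in>D. K \<subseteq> T\<rbrakk> \<Longrightarrow> K = I"
proof -
  obtain I0 where I0: "ideal I0 R" "\<And>T. T \<in> C0 \<Longrightarrow> I0 \<subseteq> T" "fin_cosets (carrier R) I0"
    using finite_irredundant_cover_ideal[OF C0 irr] by blast
  define good where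
    "good K \<longleftrightarrow> (\<exists>D. ring_cover R D \<and> finite D \<and> card D \<le> card C0 \<and> (\<forall>T\<in>D. K \<subseteq> T))" for K
  define \<I> where "\<I> = {K. ideal K R \<and> I0 \<subseteq> K \<and> good K}"
  have fin: "finite \<I>"
    unfolding \<I>_def by (rule finite_subset[OF _ finite_ideals_above[OF I0(1) finite_carrier_Quot[OF I0(1,3)]]]) auto
  have mem: "I0 \<in> \<I>"
    using I0 C0 by (auto simp: \<I>_def good_def)
  obtain I where I: "I \<in> \<I>" "\<forall>K\<in>\<I>. I \<subseteq> K \<longrightarrow> I = K"
    using finite_has_maximal2[OF fin mem] by metis
  then have I': "ideal I R" "I0 \<subseteq> I" "good I"
    by (auto simp: \<I>_def)
  then obtain C where C: "ring_cover R C" "finite C" "card C \<le> card C0" "\<And>T. T \<in> C \<Longrightarrow> I \<subseteq> T"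
    unfolding good_def by blast
  show ?thesis
  proof (rule that[OF _ _ C])
    show "ideal I R" by (rule I'(1))
    have "fin_cosets (carrier R) I"
      using I0(3) I'(2) by (rule fin_cosets_mono)
    then show "finite (carrier (R Quot I))"
      by (rule finite_carrier_Quot[OF I'(1)])
    show "K = I" if "ideal K R" "I \<subseteq> K" "ring_cover R D" "finite D" "card D \<le> card C0"
      "\<forall>T\<in>D. K \<subseteq> T" for K D
    proof -
      have "K \<in> \<I>"
        using that I'(2) unfolding \<I>_def good_def by blast
      then show ?thesis
        using I(2) that(2) by blast
    qed
  qed
qed

lemma finite_card_of_ordLeq_iff:
  assumes "finite A" "finite B"
  shows "|A| \<le>o |B| \<longleftrightarrow> card A \<le> card B"
  using card_of_ordLeq[of A B] inj_on_iff_card_le[OF assms] by blast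

theorem theorem3p12:
  fixes R :: "('a, 'm) ring_scheme"
  assumes "ring R"
    and "\<exists>C. ring_cover R C \<and> finite C"
  shows "\<exists>I (p::nat). ideal I R \<and> Factorial_Ring.prime p \<and>
           finite (carrier (R Quot I)) \<and>
           ring_characteristic (R Quot I) = p \<and>
           jacobson_radical (R Quot I) \<cdot>\<^bsub>R Quot I\<^esub> jacobson_radical (R Quot I) = {\<zero>\<^bsub>R Quot I\<^esub>} \<and>
           coverable (R Quot I) \<and> \<sigma> (R Quot I) =o \<sigma> R"
proof -
  interpret R: ring R by (rule assms(1))
  obtain C1 where C1: "ring_cover R C1" "finite C1"
    using assms(2) by blast
  then obtain C0 where C0: "minimal_ring_cover R C0"
    using minimal_ring_cover_exists coverable_def by metis
  then have C0_cover: "ring_cover R C0" and C0_min: "\<And>D. ring_cover R D \<Longrightarrow> |C0| \<le>o |D|"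
    by (auto simp: minimal_ring_cover_def)
  have C0_fin: "finite C0"
    using C0_min[OF C1(1)] C1(2) card_of_ordLeq_finite by blast
  have irr: "\<not> ring_cover R (C0 - {T})" if "T \<in> C0" for T
  proof
    assume "ring_cover R (C0 - {T})"
    then have "card C0 \<le> card (C0 - {T})"
      using C0_min finite_card_of_ordLeq_iff[of C0 "C0 - {T}"] C0_fin by blast
    then show False
      using card_Diff1_less[OF C0_fin that] by simp
  qed
  obtain I C where I: "ideal I R" "finite (carrier (R Quot I))"
    and C: "ring_cover R C" "finite C" "card C \<le> card C0" "\<And>T. T \<in> C \<Longrightarrow> I \<subseteq> T"
    and max: "\<And>K D. \<lbrakk>ideal K R; I \<subseteq> K; ring_cover R D; finite D; card D \<le> card C0; \<forall>T\<in>D. K \<subseteq> T\<rbrakk> \<Longrightarrow> K = I"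
    using R.maximal_ideal_below_cover[OF C0_cover C0_fin irr] by metis
  interpret I: ideal I R by (rule I)
  define h where "h = (+>\<^bsub>R\<^esub>) I"
  interpret h: ring_hom_ring R "R Quot I" h
    unfolding h_def by (rule I.rcos_ring_hom_ring)
  have surj: "h ` carrier R = carrier (R Quot I)"
    by (simp add: h_def I.carrier_Quot_eq)
  have ker: "a_kernel R (R Quot I) h \<subseteq> I"
    unfolding a_kernel_def' h_def using I.mem_iff_coset_eq_zero by blast
  define E where "E = (`) h ` C"
  have E: "ring_cover (R Quot I) E"
    unfolding E_def by (rule h.ring_cover_image[OF surj C(1)]) (use ker C(4) in blast)
  have card_E: "finite E" "card E \<le> card C0"
    using C(2,3) card_image_le[OF C(2)] by (auto simp: E_def intro: order_trans)
  \<comment> \<open>Otherwise the preimages \<open>D\<close> of the enlarged family would cover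
    \<open>R\<close> with at most \<open>card C0\<close> members, all containing the ideal
    \<open>K'\<close> strictly above \<open>I\<close>, against the choice of
    \<open>I\<close>.\<close>
  have no_enlargement: "K = {\<zero>\<^bsub>R Quot I\<^esub>}"
    if K: "ideal K (R Quot I)" and cov: "ring_cover (R Quot I) (h.S.enlarged E K)" for K
  proof -
    interpret K: ideal K "R Quot I" by (rule K)
    define K' where "K' = {x \<in> carrier R. h x \<in> K}"
    define D where "D = (\<lambda>X. {x \<in> carrier R. h x \<in> X}) ` h.S.enlarged E K"
    have D_fin: "finite (h.S.enlarged E K)" and D_card: "card (h.S.enlarged E K) \<le> card E"
      using h.S.enlarged_subset[of E K] card_E(1)
      by (auto intro: finite_surj surj_card_le)
    have E_sub: "K \<subseteq> X" if "X \<in> h.S.enlarged E K" for X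
    proof -
      obtain S where S: "S \<in> E" "X = S <+>\<^bsub>R Quot I\<^esub> K"
        using \<open>X \<in> h.S.enlarged E K\<close> by (auto simp: h.S.enlarged_def)
      then have "nonunital_subring S (R Quot I)"
        using E by (simp add: ring_cover_def)
      then show ?thesis
        unfolding S(2) by (rule h.S.nonunital_subring_add_ideal(3)[OF _ K])
    qed
    have "K' = I"
    proof (rule max)
      show "ideal K' R"
        unfolding K'_def by (rule h.ideal_vimage[OF K])
      show "I \<subseteq> K'"
      proof
        fix x assume x: "x \<in> I"
        then have "h x = \<zero>\<^bsub>R Quot I\<^esub>"
          using I.mem_iff_coset_eq_zero I.a_Hcarr by (simp add: h_def)
        then show "x \<in> K'"
          using I.a_Hcarr[OF x] K.zero_closed by (simp add: K'_def)
      qed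
      show "ring_cover R D"
        unfolding D_def by (rule h.ring_cover_vimage[OF surj cov])
      show "finite D"
        unfolding D_def using D_fin by blast
      show "card D \<le> card C0"
        using card_image_le[OF D_fin] D_card card_E(2) unfolding D_def by (meson order_trans)
      show "\<forall>T\<in>D. K' \<subseteq> T"
        unfolding D_def K'_def using E_sub by blast
    qed
    have "K \<subseteq> {\<zero>\<^bsub>R Quot I\<^esub>}"
    proof
      fix u assume u: "u \<in> K"
      then have "u \<in> h ` carrier R"
        unfolding surj using K.a_Hcarr by blast
      then obtain x where x: "x \<in> carrier R" "u = h x"
        by blast
      then have "x \<in> I"
        using u \<open>K' = I\<close> unfolding K'_def by blast
      then show "u \<in> {\<zero>\<^bsub>R Quot I\<^esub>}"
        using x I.mem_iff_coset_eq_zero by (simp add: h_def)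
    qed
    then show ?thesis
      using K.zero_closed by blast
  qed
  have "Factorial_Ring.prime (ring_characteristic (R Quot I))"
    using h.S.characteristic_not_prime[OF I(2) E] no_enlargement by blast
  moreover have "jacobson_radical (R Quot I) \<cdot>\<^bsub>R Quot I\<^esub> jacobson_radical (R Quot I) = {\<zero>\<^bsub>R Quot I\<^esub>}"
  proof (rule ccontr)
    assume "\<not> ?thesis"
    then obtain K where K: "ideal K (R Quot I)" "K \<noteq> {\<zero>\<^bsub>R Quot I\<^esub>}"
      "\<And>S. \<lbrakk>nonunital_subring S (R Quot I); S <+>\<^bsub>R Quot I\<^esub> K = carrier (R Quot I)\<rbrakk>
        \<Longrightarrow> S = carrier (R Quot I)"
      using h.S.jacobson_square_nonzero[OF I(2)] by metis
    have "ring_cover (R Quot I) (h.S.enlarged E K)"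
    proof (rule h.S.ring_cover_enlargedI[OF E K(1)])
      show "S = carrier (R Quot I)"
        if "S \<in> E" "S <+>\<^bsub>R Quot I\<^esub> K = carrier (R Quot I)" for S
        using K(3) that E by (simp add: ring_cover_def)
    qed
    then show False
      using no_enlargement K by blast
  qed
  moreover have E_min: "minimal_ring_cover (R Quot I) E"
    unfolding minimal_ring_cover_def
  proof (intro conjI allI impI E)
    \<comment> \<open>\<open>D\<close> may be infinite, so it is compared with \<open>C0\<close> by
      the order on cardinals; its preimages form a cover of \<open>R\<close> with no more
      members.\<close>
    fix D assume "ring_cover (R Quot I) D"
    then have "ring_cover R ((\<lambda>X. {x \<in> carrier R. h x \<in> X}) ` D)"
      by (rule h.ring_cover_vimage[OF surj])
    then have "|C0| \<le>o |D|"
      using C0_min card_of_image ordLeq_transitive by blast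
    moreover have "|E| \<le>o |C0|"
      using card_E C0_fin by (simp add: finite_card_of_ordLeq_iff)
    ultimately show "|E| \<le>o |D|"
      using ordLeq_transitive by blast
  qed
  \<comment> \<open>\<open>\<sigma>\<close> refers to an arbitrarily chosen minimal cover, so both
    sides are compared through the known minimal covers \<open>E\<close> and
    \<open>C0\<close>.\<close>
  moreover have "\<sigma> (R Quot I) =o \<sigma> R"
  proof -
    have "|C0| \<le>o |E|"
    proof -
      have "|C0| \<le>o |(\<lambda>X. {x \<in> carrier R. h x \<in> X}) ` E|"
        by (rule C0_min[OF h.ring_cover_vimage[OF surj E]])
      then show ?thesis
        using card_of_image ordLeq_transitive by blast
    qed
    moreover have "|E| \<le>o |C0|"
      using card_E C0_fin by (simp add: finite_card_of_ordLeq_iff)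
    ultimately have "|E| =o |C0|"
      by (simp add: ordIso_iff_ordLeq)
    then show ?thesis
      using covering_number_ordIso[OF E_min] covering_number_ordIso[OF C0]
      by (meson ordIso_symmetric ordIso_transitive)
  qed
  ultimately show ?thesis
    using I E unfolding coverable_def by blast
qed

end
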